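(* Let $\mathcal{C}$ be the category of racks or the category of quandles. The Galois structure $\Gamma^1=(\mathsf{Ext}(\mathcal{C}),\mathsf{CExt}(\mathcal{C}),F_1,\mathrm{I},\eta^1,\epsilon^1,\mathcal{E}^1)$ is strongly $\mathcal{E}^1$-Birkhoff, i.e. for every double extension $\alpha=(\alpha_\top,\alpha_\perp)\colon f_A\to f_B$ in $\mathcal{C}$, the reflection square $(\eta^1_{f_A},\eta^1_{f_B})\colon\alpha\to F_1(\alpha)$ at $\alpha$ is a $3$-fold extension. That is, $\alpha$, $F_1(\alpha)\colon F_1(f_A)\to F_1(f_B)$, $\eta^1_{f_A}$, $\eta^1_{f_B}$ and the comparison morphism $f_A\to f_B\times_{F_1(f_B)}F_1(f_A)$ in $\mathsf{Ext}(\mathcal{C})$ are all double extensions.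
   Context: A rack is a set $A$ with binary operations $\triangleleft,\triangleleft^{-1}$ such that $(x\triangleleft a)\triangleleft^{-1}a=x=(x\triangleleft^{-1}a)\triangleleft a$ and $(x\triangleleft a)\triangleleft b=(x\triangleleft b)\triangleleft(a\triangleleft b)$ for all $x,a,b\in A$. A quandle is a rack with $a\triangleleft a=a$ for all $a$. Morphisms are functions preserving $\triangleleft$. Unbracketed expressions are evaluated from left to right. Let $\mathcal{C}$ be the category of racks or of quandles. An extension is a surjective morphism of $\mathcal{C}$. $\mathsf{Ext}(\mathcal{C})$ is the category whose objects are extensions and whose morphisms $\alpha=(\alpha_\top,\alpha_\perp)\colon f_A\to f_B$, for $f_A\colon A_\top\to A_\perp$ and $f_B\colon B_\top\to B_\perp$, are pairs $\alpha_\top\colon A_\top\to B_\top$, $\alpha_\perp\colon A_\perp\to B_\perp$ with $f_B\alpha_\top=\alpha_\perp f_A$. Such an $\alpha$ is a double extension if $\alpha_\top$, $\alpha_\perp$ and the comparison map $A_\top\to A_\perp\times_{B_\perp}B_\top$ induced by $f_A$ and $\alpha_\top$ are all surjective. $\mathcal{E}^1$ is the class of double extensions. Pullbacks along double extensions in $\mathsf{Ext}(\mathcal{C})$ exist and are computed component-wise in $\mathcal{C}$. An extension $f\colon A\to B$ is a covering if $x\triangleleft a=x\triangleleft b$ for all $x,a,b\in A$ with $f(a)=f(b)$. $\mathsf{CExt}(\mathcal{C})$ is the full subcategory of $\mathsf{Ext}(\mathcal{C})$ of coverings, with inclusion $\mathrm{I}$. The functor $F_1\colon\mathsf{Ext}(\mathcal{C})\to\mathsf{CExt}(\mathcal{C})$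 is the left adjoint of $\mathrm{I}$: it sends $f\colon A\to B$ to the induced map $A/C_1(f)\to B$, where $C_1(f)$ is the congruence on $A$ generated by the pairs $(x\triangleleft a\triangleleft^{-1}b,x)$ with $x,a,b\in A$, $f(a)=f(b)$; the unit is $\eta^1_f=(A\to A/C_1(f),\mathrm{id}_B)$ and $\epsilon^1$ is the counit. A $3$-fold extension $(\sigma,\beta)\colon\gamma\to\alpha$ is a commutative square $\alpha\sigma=\beta\gamma$ in $\mathsf{Ext}(\mathcal{C})$, where $\gamma\colon f_C\to f_D$ and $\alpha\colon f_A\to f_B$ are double extensions, such that $\sigma\colon f_C\to f_A$, $\beta\colon f_D\to f_B$ and the comparison morphism $f_C\to f_D\times_{f_B}f_A$ to the pullback of $\beta$ and $\alpha$ in $\mathsf{Ext}(\mathcal{C})$ are double extensions. *)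

theory Defs
  imports "HOL-Algebra.Congruence"
begin

record 'a rack_struct = "'a partial_object" +
  tri :: "'a \<Rightarrow> 'a \<Rightarrow> 'a" (infixl "\<lhd>\<index>" 70)
  trinv :: "'a \<Rightarrow> 'a \<Rightarrow> 'a" (infixl "\<rhd>\<index>" 70)

text \<open>
  The field \<open>trinv\<close> is the operation \<open>\<lhd>\<close> to the power \<open>-1\<close>; it is written
  with the symbol \<open>\<rhd>\<close>, but the acted-upon element is still the left argument. Carriers may be empty.
\<close>

locale rack =
  fixes A (structure)
  assumes tri_closed: "x \<in> carrier A \<Longrightarrow> a \<in> carrier A \<Longrightarrow> x \<lhd> a \<in> carrier A"
    and trinv_closed: "x \<in> carrier A \<Longrightarrow> a \<in> carrier A \<Longrightarrow> x \<rhd> a \<in> carrier A"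
    and tri_trinv: "x \<in> carrier A \<Longrightarrow> a \<in> carrier A \<Longrightarrow> x \<lhd> a \<rhd> a = x"
    and trinv_tri: "x \<in> carrier A \<Longrightarrow> a \<in> carrier A \<Longrightarrow> x \<rhd> a \<lhd> a = x"
    and self_distrib: "x \<in> carrier A \<Longrightarrow> a \<in> carrier A \<Longrightarrow> b \<in> carrier A \<Longrightarrow>
      x \<lhd> a \<lhd> b = (x \<lhd> b) \<lhd> (a \<lhd> b)"

locale quandle = rack +
  assumes idem: "a \<in> carrier A \<Longrightarrow> a \<lhd> a = a"

datatype rack_category = Racks | Quandles

fun obj :: "rack_category \<Rightarrow> ('a, 'm) rack_struct_scheme \<Rightarrow> bool" where
  "obj Racks A = rack A"
| "obj Quandles A = quandle A"

definition rack_hom :: "('a, 'm) rack_struct_scheme \<Rightarrow> ('b, 'n) rack_struct_scheme \<Rightarrow> ('a \<Rightarrow> 'b) set" where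
  "rack_hom A B = {h \<in> carrier A \<rightarrow> carrier B.
     \<forall>x\<in>carrier A. \<forall>a\<in>carrier A. h (x \<lhd>\<^bsub>A\<^esub> a) = h x \<lhd>\<^bsub>B\<^esub> h a}"

definition rack_pullback ::
  "'a rack_struct \<Rightarrow> 'b rack_struct \<Rightarrow> ('a \<Rightarrow> 'c) \<Rightarrow> ('b \<Rightarrow> 'c) \<Rightarrow> ('a \<times> 'b) rack_struct" where
  "rack_pullback A B h k =
     \<lparr>carrier = {(x, y). x \<in> carrier A \<and> y \<in> carrier B \<and> h x = k y},
      tri = (\<lambda>(x, y) (a, b). (x \<lhd>\<^bsub>A\<^esub> a, y \<lhd>\<^bsub>B\<^esub> b)),
      trinv = (\<lambda>(x, y) (a, b). (x \<rhd>\<^bsub>A\<^esub> a, y \<rhd>\<^bsub>B\<^esub> b))\<rparr>"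


section \<open>Congruences and quotients\<close>

definition rack_congruence :: "'a rack_struct \<Rightarrow> ('a \<times> 'a) set \<Rightarrow> bool" where
  "rack_congruence A R \<longleftrightarrow> equiv (carrier A) R \<and>
     (\<forall>(x, y)\<in>R. \<forall>(a, b)\<in>R. (x \<lhd>\<^bsub>A\<^esub> a, y \<lhd>\<^bsub>A\<^esub> b) \<in> R \<and> (x \<rhd>\<^bsub>A\<^esub> a, y \<rhd>\<^bsub>A\<^esub> b) \<in> R)"

definition generated_congruence :: "'a rack_struct \<Rightarrow> ('a \<times> 'a) set \<Rightarrow> ('a \<times> 'a) set" where
  "generated_congruence A S = \<Inter>{R. rack_congruence A R \<and> S \<subseteq> R}"

definition rack_quotient :: "'a rack_struct \<Rightarrow> ('a \<times> 'a) set \<Rightarrow> 'a set rack_struct" where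
  "rack_quotient A R =
     \<lparr>carrier = carrier A // R,
      tri = (\<lambda>X Y. \<Union>x\<in>X. \<Union>y\<in>Y. R `` {x \<lhd>\<^bsub>A\<^esub> y}),
      trinv = (\<lambda>X Y. \<Union>x\<in>X. \<Union>y\<in>Y. R `` {x \<rhd>\<^bsub>A\<^esub> y})\<rparr>"


section \<open>Extensions and double extensions\<close>

record ('a, 'b) arrow =
  src :: "'a rack_struct"
  tgt :: "'b rack_struct"
  arr :: "'a \<Rightarrow> 'b"

definition extension :: "rack_category \<Rightarrow> ('a, 'b) arrow \<Rightarrow> bool" where
  "extension \<C> f \<longleftrightarrow> obj \<C> (src f) \<and> obj \<C> (tgt f) \<and>
     arr f \<in> rack_hom (src f) (tgt f) \<and>
     arr f ` carrier (src f) = carrier (tgt f)"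

text \<open>A morphism of extensions is the pair of its top and bottom components.\<close>

definition ext_hom ::
  "('a, 'b) arrow \<Rightarrow> ('c, 'd) arrow \<Rightarrow> (('a \<Rightarrow> 'c) \<times> ('b \<Rightarrow> 'd)) set" where
  "ext_hom f g = {\<alpha>. fst \<alpha> \<in> rack_hom (src f) (src g) \<and>
     snd \<alpha> \<in> rack_hom (tgt f) (tgt g) \<and>
     (\<forall>x\<in>carrier (src f). arr g (fst \<alpha> x) = snd \<alpha> (arr f x))}"

text \<open>Functions are only relevant on carriers, so this is equality of parallel morphisms out of \<open>f\<close>.\<close>

definition ext_hom_eq ::
  "('a, 'b) arrow \<Rightarrow> ('a \<Rightarrow> 'c) \<times> ('b \<Rightarrow> 'd) \<Rightarrow> ('a \<Rightarrow> 'c) \<times> ('b \<Rightarrow> 'd) \<Rightarrow> bool" where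
  "ext_hom_eq f \<alpha> \<beta> \<longleftrightarrow> (\<forall>x\<in>carrier (src f). fst \<alpha> x = fst \<beta> x) \<and>
     (\<forall>x\<in>carrier (tgt f). snd \<alpha> x = snd \<beta> x)"

definition ext_comp ::
  "('b \<Rightarrow> 'c) \<times> ('e \<Rightarrow> 'f) \<Rightarrow> ('a \<Rightarrow> 'b) \<times> ('d \<Rightarrow> 'e) \<Rightarrow> ('a \<Rightarrow> 'c) \<times> ('d \<Rightarrow> 'f)" where
  "ext_comp \<beta> \<alpha> = (fst \<beta> \<circ> fst \<alpha>, snd \<beta> \<circ> snd \<alpha>)"

definition double_extension ::
  "rack_category \<Rightarrow> ('a, 'b) arrow \<Rightarrow> ('c, 'd) arrow \<Rightarrow> ('a \<Rightarrow> 'c) \<times> ('b \<Rightarrow> 'd) \<Rightarrow> bool" where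
  "double_extension \<C> f g \<alpha> \<longleftrightarrow>
     extension \<C> f \<and> extension \<C> g \<and> \<alpha> \<in> ext_hom f g \<and>
     fst \<alpha> ` carrier (src f) = carrier (src g) \<and>
     snd \<alpha> ` carrier (tgt f) = carrier (tgt g) \<and>
     (\<lambda>x. (arr f x, fst \<alpha> x)) ` carrier (src f) =
       carrier (rack_pullback (tgt f) (src g) (snd \<alpha>) (arr g))"

text \<open>The component-wise pullback of \<open>\<beta> : f \<rightarrow> h\<close> and \<open>\<alpha> : g \<rightarrow> h\<close>; the common codomain
  \<open>h\<close> does not enter the construction.\<close>

definition ext_pullback ::
  "('a, 'b) arrow \<Rightarrow> ('c, 'd) arrow \<Rightarrow> ('a \<Rightarrow> 'e) \<times> ('b \<Rightarrow> 'f) \<Rightarrow> ('c \<Rightarrow> 'e) \<times> ('d \<Rightarrow> 'f) \<Rightarrow>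
     ('a \<times> 'c, 'b \<times> 'd) arrow" where
  "ext_pullback f g \<beta> \<alpha> =
     \<lparr>src = rack_pullback (src f) (src g) (fst \<beta>) (fst \<alpha>),
      tgt = rack_pullback (tgt f) (tgt g) (snd \<beta>) (snd \<alpha>),
      arr = map_prod (arr f) (arr g)\<rparr>"

definition ext_pair ::
  "('a \<Rightarrow> 'c) \<times> ('b \<Rightarrow> 'd) \<Rightarrow> ('a \<Rightarrow> 'e) \<times> ('b \<Rightarrow> 'f) \<Rightarrow> ('a \<Rightarrow> 'c \<times> 'e) \<times> ('b \<Rightarrow> 'd \<times> 'f)" where
  "ext_pair \<gamma> \<sigma> = (\<lambda>x. (fst \<gamma> x, fst \<sigma> x), \<lambda>x. (snd \<gamma> x, snd \<sigma> x))"

text \<open>The square with sides \<open>\<gamma> : fC \<rightarrow> fD\<close>, \<open>\<alpha> : fA \<rightarrow> fB\<close>, \<open>\<sigma> : fC \<rightarrow> fA\<close>, \<open>\<beta> : fD \<rightarrow> fB\<close>.\<close>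

definition three_fold_extension ::
  "rack_category \<Rightarrow> ('c1, 'c2) arrow \<Rightarrow> ('d1, 'd2) arrow \<Rightarrow> ('a1, 'a2) arrow \<Rightarrow> ('b1, 'b2) arrow \<Rightarrow>
     ('c1 \<Rightarrow> 'd1) \<times> ('c2 \<Rightarrow> 'd2) \<Rightarrow> ('a1 \<Rightarrow> 'b1) \<times> ('a2 \<Rightarrow> 'b2) \<Rightarrow>
     ('c1 \<Rightarrow> 'a1) \<times> ('c2 \<Rightarrow> 'a2) \<Rightarrow> ('d1 \<Rightarrow> 'b1) \<times> ('d2 \<Rightarrow> 'b2) \<Rightarrow> bool" where
  "three_fold_extension \<C> fC fD fA fB \<gamma> \<alpha> \<sigma> \<beta> \<longleftrightarrow>
     double_extension \<C> fC fD \<gamma> \<and>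
     double_extension \<C> fA fB \<alpha> \<and>
     double_extension \<C> fC fA \<sigma> \<and>
     double_extension \<C> fD fB \<beta> \<and>
     ext_hom_eq fC (ext_comp \<alpha> \<sigma>) (ext_comp \<beta> \<gamma>) \<and>
     double_extension \<C> fC (ext_pullback fD fA \<beta> \<alpha>) (ext_pair \<gamma> \<sigma>)"


section \<open>Coverings and the reflector\<close>

definition covering :: "rack_category \<Rightarrow> ('a, 'b) arrow \<Rightarrow> bool" where
  "covering \<C> f \<longleftrightarrow> extension \<C> f \<and>
     (\<forall>x\<in>carrier (src f). \<forall>a\<in>carrier (src f). \<forall>b\<in>carrier (src f).
        arr f a = arr f b \<longrightarrow> x \<lhd>\<^bsub>src f\<^esub> a = x \<lhd>\<^bsub>src f\<^esub> b)"

definition C1 :: "('a, 'b) arrow \<Rightarrow> ('a \<times> 'a) set" where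
  "C1 f = generated_congruence (src f)
     {(x \<lhd>\<^bsub>src f\<^esub> a \<rhd>\<^bsub>src f\<^esub> b, x) | x a b.
        x \<in> carrier (src f) \<and> a \<in> carrier (src f) \<and> b \<in> carrier (src f) \<and>
        arr f a = arr f b}"

text \<open>On a congruence class \<open>X\<close>, the set \<open>arr f ` X\<close> is a singleton, because \<open>C1 f\<close> is contained
  in the kernel of \<open>f\<close>.\<close>

definition F1 :: "('a, 'b) arrow \<Rightarrow> ('a set, 'b) arrow" where
  "F1 f = \<lparr>src = rack_quotient (src f) (C1 f), tgt = tgt f,
           arr = (\<lambda>X. the_elem (arr f ` X))\<rparr>"

text \<open>Only the codomain \<open>g\<close> of \<open>\<alpha> : f \<rightarrow> g\<close> is needed to write down the induced map of quotients.\<close>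

definition F1_map ::
  "('c, 'd) arrow \<Rightarrow> ('a \<Rightarrow> 'c) \<times> ('b \<Rightarrow> 'd) \<Rightarrow> ('a set \<Rightarrow> 'c set) \<times> ('b \<Rightarrow> 'd)" where
  "F1_map g \<alpha> = (\<lambda>X. \<Union>x\<in>X. C1 g `` {fst \<alpha> x}, snd \<alpha>)"

definition eta1 :: "('a, 'b) arrow \<Rightarrow> ('a \<Rightarrow> 'a set) \<times> ('b \<Rightarrow> 'b)" where
  "eta1 f = (\<lambda>x. C1 f `` {x}, id)"


section \<open>\<open>F1\<close> is the reflector of extensions onto coverings\<close>

lemma rack_of_obj: "obj \<C> A \<Longrightarrow> rack A"
  by (cases \<C>) (auto simp: quandle_def)

lemma hom_trinv:
  assumes "rack A" "rack B" "h \<in> rack_hom A B" "x \<in> carrier A" "a \<in> carrier A"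
  shows "h (x \<rhd>\<^bsub>A\<^esub> a) = h x \<rhd>\<^bsub>B\<^esub> h a"
proof -
  interpret A: rack A by fact
  interpret B: rack B by fact
  have m: "x \<rhd>\<^bsub>A\<^esub> a \<in> carrier A" using assms A.trinv_closed by auto
  have "h (x \<rhd>\<^bsub>A\<^esub> a) \<lhd>\<^bsub>B\<^esub> h a = h (x \<rhd>\<^bsub>A\<^esub> a \<lhd>\<^bsub>A\<^esub> a)"
    using assms m by (auto simp: rack_hom_def)
  also have "\<dots> = h x" using A.trinv_tri assms by simp
  finally have "h (x \<rhd>\<^bsub>A\<^esub> a) \<lhd>\<^bsub>B\<^esub> h a = h x" .
  moreover have "h (x \<rhd>\<^bsub>A\<^esub> a) \<in> carrier B" "h a \<in> carrier B"
    using assms m by (auto simp: rack_hom_def)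
  ultimately show ?thesis using B.tri_trinv[of "h (x \<rhd>\<^bsub>A\<^esub> a)" "h a"] by simp
qed

lemma kernel_congruence:
  assumes "rack A" "rack B" "h \<in> rack_hom A B"
  shows "rack_congruence A {(x, y). x \<in> carrier A \<and> y \<in> carrier A \<and> h x = h y}"
proof -
  interpret A: rack A by fact
  show ?thesis
    unfolding rack_congruence_def
    using assms(3) hom_trinv[OF assms] A.tri_closed A.trinv_closed
    by (auto simp: rack_hom_def equiv_def refl_on_def sym_def trans_def)
qed

lemma generated_congruence_least:
  "rack_congruence A R \<Longrightarrow> S \<subseteq> R \<Longrightarrow> generated_congruence A S \<subseteq> R"
  by (auto simp: generated_congruence_def)

lemma generated_congruence:
  assumes "rack A" "S \<subseteq> carrier A \<times> carrier A"
  shows "rack_congruence A (generated_congruence A S)" "S \<subseteq> generated_congruence A S"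
proof -
  interpret A: rack A by fact
  let ?F = "{R. rack_congruence A R \<and> S \<subseteq> R}"
  have top: "rack_congruence A (carrier A \<times> carrier A)"
    by (auto simp: rack_congruence_def equiv_def refl_on_def sym_def trans_def
        A.tri_closed A.trinv_closed)
  have sub: "\<Inter>?F \<subseteq> carrier A \<times> carrier A"
    using top assms(2) by auto
  have e: "equiv (carrier A) R" if "R \<in> ?F" for R
    using that by (simp add: rack_congruence_def)
  have "equiv (carrier A) (\<Inter>?F)"
  proof (rule equivI)
    show "\<Inter>?F \<subseteq> carrier A \<times> carrier A" by (rule sub)
    show "refl_on (carrier A) (\<Inter>?F)"
      using e by (meson InterI equivE refl_onD refl_onI)
    show "sym (\<Inter>?F)"
      using e by (meson InterD InterI equivE symD symI)
    show "trans (\<Inter>?F)"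
      using e by (meson InterD InterI equivE transD transI)
  qed
  moreover have "(x \<lhd>\<^bsub>A\<^esub> a, y \<lhd>\<^bsub>A\<^esub> b) \<in> R \<and> (x \<rhd>\<^bsub>A\<^esub> a, y \<rhd>\<^bsub>A\<^esub> b) \<in> R"
    if "R \<in> ?F" "(x, y) \<in> \<Inter>?F" "(a, b) \<in> \<Inter>?F" for R x y a b
  proof -
    have "rack_congruence A R" "(x, y) \<in> R" "(a, b) \<in> R" using that by blast+
    then show ?thesis unfolding rack_congruence_def by fast
  qed
  ultimately show "rack_congruence A (generated_congruence A S)"
    unfolding generated_congruence_def rack_congruence_def[of A "\<Inter>?F"] by blast
  show "S \<subseteq> generated_congruence A S"
    by (auto simp: generated_congruence_def)
qed

lemma carrier_quotient [simp]: "carrier (rack_quotient A R) = carrier A // R"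
  by (simp add: rack_quotient_def)

lemma quotient_ops:
  assumes R: "rack_congruence A R" and xy: "x \<in> carrier A" "y \<in> carrier A"
  shows "R `` {x} \<lhd>\<^bsub>rack_quotient A R\<^esub> R `` {y} = R `` {x \<lhd>\<^bsub>A\<^esub> y}"
    and "R `` {x} \<rhd>\<^bsub>rack_quotient A R\<^esub> R `` {y} = R `` {x \<rhd>\<^bsub>A\<^esub> y}"
proof -
  have e: "equiv (carrier A) R" using R by (simp add: rack_congruence_def)
  have c: "congruent2 R R (\<lambda>x y. R `` {x \<lhd>\<^bsub>A\<^esub> y})" "congruent2 R R (\<lambda>x y. R `` {x \<rhd>\<^bsub>A\<^esub> y})"
    using R e by (auto simp: congruent2_def rack_congruence_def intro!: equiv_class_eq[OF e])
  show "R `` {x} \<lhd>\<^bsub>rack_quotient A R\<^esub> R `` {y} = R `` {x \<lhd>\<^bsub>A\<^esub> y}"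
    "R `` {x} \<rhd>\<^bsub>rack_quotient A R\<^esub> R `` {y} = R `` {x \<rhd>\<^bsub>A\<^esub> y}"
    using UN_equiv_class2[OF e e c(1) xy] UN_equiv_class2[OF e e c(2) xy]
    by (simp_all add: rack_quotient_def)
qed

lemma obj_quotient:
  assumes "obj \<C> A" "rack_congruence A R"
  shows "obj \<C> (rack_quotient A R)"
proof -
  interpret A: rack A using assms(1) by (rule rack_of_obj)
  have r: "rack (rack_quotient A R)"
  proof (standard, goal_cases)
    case (5 X Y Z)
    then obtain x y z where
      "X = R `` {x}" "Y = R `` {y}" "Z = R `` {z}" "x \<in> carrier A" "y \<in> carrier A" "z \<in> carrier A"
      by (auto elim!: quotientE)
    then show ?case
      using A.self_distrib[of x y z] by (simp add: quotient_ops[OF assms(2)] A.tri_closed)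
  qed (auto elim!: quotientE simp: quotient_ops[OF assms(2)] A.tri_closed A.trinv_closed
         A.tri_trinv A.trinv_tri intro!: quotientI)
  show ?thesis
  proof (cases \<C>)
    case Racks
    then show ?thesis using r by simp
  next
    case Quandles
    then interpret quandle A using assms(1) by simp
    have "quandle (rack_quotient A R)"
      by (intro quandle.intro r quandle_axioms.intro)
        (auto elim!: quotientE simp: quotient_ops[OF assms(2)] idem)
    then show ?thesis using Quandles by simp
  qed
qed

lemma C1_props:
  assumes "extension \<C> f"
  shows "rack_congruence (src f) (C1 f)"
    and "\<lbrakk>x \<in> carrier (src f); a \<in> carrier (src f); b \<in> carrier (src f);
          arr f a = arr f b\<rbrakk> \<Longrightarrow> (x \<lhd>\<^bsub>src f\<^esub> a \<rhd>\<^bsub>src f\<^esub> b, x) \<in> C1 f"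
    and "(x, y) \<in> C1 f \<Longrightarrow> arr f x = arr f y"
proof -
  let ?A = "src f"
  let ?S = "{(x \<lhd>\<^bsub>?A\<^esub> a \<rhd>\<^bsub>?A\<^esub> b, x) | x a b.
        x \<in> carrier ?A \<and> a \<in> carrier ?A \<and> b \<in> carrier ?A \<and> arr f a = arr f b}"
  have rA: "rack ?A" and rB: "rack (tgt f)" and h: "arr f \<in> rack_hom ?A (tgt f)"
    using assms rack_of_obj by (auto simp: extension_def)
  interpret A: rack ?A by (rule rA)
  interpret B: rack "tgt f" by (rule rB)
  have S: "?S \<subseteq> carrier ?A \<times> carrier ?A"
    by (auto simp: A.tri_closed A.trinv_closed)
  show "rack_congruence ?A (C1 f)"
    unfolding C1_def by (rule generated_congruence(1)[OF rA S])
  show "(x \<lhd>\<^bsub>?A\<^esub> a \<rhd>\<^bsub>?A\<^esub> b, x) \<in> C1 f"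
    if "x \<in> carrier ?A" "a \<in> carrier ?A" "b \<in> carrier ?A" "arr f a = arr f b"
    unfolding C1_def
    by (rule subsetD[OF generated_congruence(2)[OF rA S]]) (use that in blast)
  have hc: "arr f x \<in> carrier (tgt f)" if "x \<in> carrier ?A" for x
    using h that by (auto simp: rack_hom_def)
  have K: "?S \<subseteq> {(x, y). x \<in> carrier ?A \<and> y \<in> carrier ?A \<and> arr f x = arr f y}"
  proof clarsimp
    fix x a b
    assume c: "x \<in> carrier ?A" "a \<in> carrier ?A" "b \<in> carrier ?A" and ab: "arr f a = arr f b"
    have "arr f (x \<lhd>\<^bsub>?A\<^esub> a \<rhd>\<^bsub>?A\<^esub> b) = arr f (x \<lhd>\<^bsub>?A\<^esub> a) \<rhd>\<^bsub>tgt f\<^esub> arr f b"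
      by (rule hom_trinv[OF rA rB h A.tri_closed[OF c(1,2)] c(3)])
    also have "\<dots> = arr f x \<lhd>\<^bsub>tgt f\<^esub> arr f a \<rhd>\<^bsub>tgt f\<^esub> arr f a"
      using h c ab by (auto simp: rack_hom_def)
    also have "\<dots> = arr f x"
      by (rule B.tri_trinv[OF hc[OF c(1)] hc[OF c(2)]])
    finally show "x \<lhd>\<^bsub>?A\<^esub> a \<rhd>\<^bsub>?A\<^esub> b \<in> carrier ?A \<and> arr f (x \<lhd>\<^bsub>?A\<^esub> a \<rhd>\<^bsub>?A\<^esub> b) = arr f x"
      using c A.tri_closed A.trinv_closed by simp
  qed
  show "arr f x = arr f y" if "(x, y) \<in> C1 f"
    using subsetD[OF generated_congruence_least[OF kernel_congruence[OF rA rB h] K]] that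
    unfolding C1_def by blast
qed

lemma arr_F1:
  assumes "extension \<C> f" "x \<in> carrier (src f)"
  shows "arr (F1 f) (C1 f `` {x}) = arr f x"
proof -
  have "(x, x) \<in> C1 f"
    using C1_props(1)[OF assms(1)] assms(2)
    by (auto simp: rack_congruence_def equiv_def refl_on_def)
  then have "C1 f `` {x} \<noteq> {}" by blast
  moreover have "arr f y = arr f x" if "y \<in> C1 f `` {x}" for y
    using C1_props(3)[OF assms(1), of x y] that by simp
  ultimately have "the_elem (arr f ` (C1 f `` {x})) = arr f x"
    by (rule the_elem_image_unique)
  then show ?thesis by (simp add: F1_def)
qed

lemma covering_extension: "covering \<C> f \<Longrightarrow> extension \<C> f"
  unfolding covering_def by blast

theorem covering_F1:
  assumes f: "extension \<C> f"
  shows "covering \<C> (F1 f)"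
proof -
  let ?A = "src f" and ?Q = "src (F1 f)"
  have R: "rack_congruence ?A (C1 f)" by (rule C1_props(1)[OF f])
  then have e: "equiv (carrier ?A) (C1 f)" by (simp add: rack_congruence_def)
  have o: "obj \<C> ?A" and h: "arr f \<in> rack_hom ?A (tgt f)"
    and s: "arr f ` carrier ?A = carrier (tgt f)"
    using f by (auto simp: extension_def)
  interpret A: rack ?A using o by (rule rack_of_obj)
  have Q: "?Q = rack_quotient ?A (C1 f)" and B: "tgt (F1 f) = tgt f"
    by (simp_all add: F1_def)
  have "arr (F1 f) \<in> rack_hom ?Q (tgt (F1 f))"
    using h unfolding B Q
    by (auto simp: rack_hom_def quotient_ops[OF R] arr_F1[OF f] A.tri_closed elim!: quotientE)
  moreover have "arr (F1 f) ` carrier ?Q = carrier (tgt (F1 f))"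
  proof -
    have "carrier ?Q = (\<lambda>x. C1 f `` {x}) ` carrier ?A"
      by (auto simp: Q quotient_def)
    then show ?thesis
      using arr_F1[OF f] by (simp add: B s[symmetric] image_image)
  qed
  ultimately have ext: "extension \<C> (F1 f)"
    using obj_quotient[OF o R] f by (simp add: extension_def Q B)
  have coll: "C1 f `` {x \<lhd>\<^bsub>?A\<^esub> a} = C1 f `` {x \<lhd>\<^bsub>?A\<^esub> b}"
    if c: "x \<in> carrier ?A" "a \<in> carrier ?A" "b \<in> carrier ?A" and ab: "arr f a = arr f b" for x a b
  proof -
    have "(x \<lhd>\<^bsub>?A\<^esub> a \<rhd>\<^bsub>?A\<^esub> b, x) \<in> C1 f" by (rule C1_props(2)[OF f c ab])
    moreover have "(b, b) \<in> C1 f" using e c by (auto simp: equiv_def refl_on_def)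
    ultimately have "(x \<lhd>\<^bsub>?A\<^esub> a \<rhd>\<^bsub>?A\<^esub> b \<lhd>\<^bsub>?A\<^esub> b, x \<lhd>\<^bsub>?A\<^esub> b) \<in> C1 f"
      using R by (auto simp: rack_congruence_def)
    then have "(x \<lhd>\<^bsub>?A\<^esub> a, x \<lhd>\<^bsub>?A\<^esub> b) \<in> C1 f"
      using c by (simp add: A.trinv_tri A.tri_closed)
    then show ?thesis by (rule equiv_class_eq[OF e])
  qed
  show ?thesis
    unfolding covering_def
  proof (intro conjI ext ballI impI)
    fix X Y Z
    assume "X \<in> carrier ?Q" "Y \<in> carrier ?Q" "Z \<in> carrier ?Q"
      and eq: "arr (F1 f) Y = arr (F1 f) Z"
    then obtain x y z where
      X: "X = C1 f `` {x}" "Y = C1 f `` {y}" "Z = C1 f `` {z}"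
      and c: "x \<in> carrier ?A" "y \<in> carrier ?A" "z \<in> carrier ?A"
      unfolding Q carrier_quotient by (elim quotientE) blast
    have "arr f y = arr f z" using eq c by (simp add: X arr_F1[OF f])
    then show "X \<lhd>\<^bsub>?Q\<^esub> Y = X \<lhd>\<^bsub>?Q\<^esub> Z"
      unfolding Q X quotient_ops(1)[OF R c(1,2)] quotient_ops(1)[OF R c(1,3)]
      by (rule coll[OF c])
  qed
qed

theorem eta1_hom:
  assumes f: "extension \<C> f"
  shows "eta1 f \<in> ext_hom f (F1 f)"
proof -
  have Q: "src (F1 f) = rack_quotient (src f) (C1 f)" and B: "tgt (F1 f) = tgt f"
    by (simp_all add: F1_def)
  show ?thesis
    by (auto simp: ext_hom_def eta1_def rack_hom_def arr_F1[OF f] Q B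
        quotient_ops[OF C1_props(1)[OF f]] intro: quotientI)
qed

theorem eta1_universal:
  assumes f: "extension \<C> f" and g: "covering \<C> g" and \<alpha>: "\<alpha> \<in> ext_hom f g"
  shows "\<exists>\<beta>\<in>ext_hom (F1 f) g. ext_hom_eq f (ext_comp \<beta> (eta1 f)) \<alpha> \<and>
    (\<forall>\<beta>'\<in>ext_hom (F1 f) g. ext_hom_eq f (ext_comp \<beta>' (eta1 f)) \<alpha> \<longrightarrow> ext_hom_eq (F1 f) \<beta>' \<beta>)"
proof -
  let ?A = "src f" and ?B = "src g" and ?h = "fst \<alpha>"
  have R: "rack_congruence ?A (C1 f)" by (rule C1_props(1)[OF f])
  have rA: "rack ?A" and rB: "rack ?B" and h: "?h \<in> rack_hom ?A ?B"
    using f covering_extension[OF g] \<alpha> unfolding extension_def ext_hom_def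
    by (blast intro: rack_of_obj)+
  interpret A: rack ?A by (rule rA)
  interpret B: rack ?B by (rule rB)
  have hc: "?h x \<in> carrier ?B" if "x \<in> carrier ?A" for x
    using h that by (auto simp: rack_hom_def)
  have "C1 f \<subseteq> {(x, y). x \<in> carrier ?A \<and> y \<in> carrier ?A \<and> ?h x = ?h y}"
    unfolding C1_def
  proof (rule generated_congruence_least[OF kernel_congruence[OF rA rB h]], clarsimp)
    fix x a b
    assume c: "x \<in> carrier ?A" "a \<in> carrier ?A" "b \<in> carrier ?A" and ab: "arr f a = arr f b"
    have gab: "arr g (?h a) = arr g (?h b)"
      using \<alpha> c ab by (auto simp: ext_hom_def)
    have "?h (x \<lhd>\<^bsub>?A\<^esub> a \<rhd>\<^bsub>?A\<^esub> b) = ?h (x \<lhd>\<^bsub>?A\<^esub> a) \<rhd>\<^bsub>?B\<^esub> ?h b"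
      by (rule hom_trinv[OF rA rB h A.tri_closed[OF c(1,2)] c(3)])
    also have "?h (x \<lhd>\<^bsub>?A\<^esub> a) = ?h x \<lhd>\<^bsub>?B\<^esub> ?h a"
      using h c unfolding rack_hom_def by blast
    also have "?h x \<lhd>\<^bsub>?B\<^esub> ?h a = ?h x \<lhd>\<^bsub>?B\<^esub> ?h b"
      using g gab hc c unfolding covering_def by blast
    finally show "x \<lhd>\<^bsub>?A\<^esub> a \<rhd>\<^bsub>?A\<^esub> b \<in> carrier ?A \<and> ?h (x \<lhd>\<^bsub>?A\<^esub> a \<rhd>\<^bsub>?A\<^esub> b) = ?h x"
      using c hc by (simp add: A.tri_closed A.trinv_closed B.tri_trinv)
  qed
  then have C: "?h x = ?h y" if "(x, y) \<in> C1 f" for x y using that by blast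
  have val: "the_elem (?h ` (C1 f `` {x})) = ?h x" if "x \<in> carrier ?A" for x
  proof -
    have "(x, x) \<in> C1 f" using R that by (auto simp: rack_congruence_def equiv_def refl_on_def)
    then have "C1 f `` {x} \<noteq> {}" by blast
    moreover have "?h y = ?h x" if "y \<in> C1 f `` {x}" for y
      using C[of x y] that by simp
    ultimately show ?thesis by (rule the_elem_image_unique)
  qed
  let ?b = "(\<lambda>X. the_elem (?h ` X), snd \<alpha>)"
  have Q: "src (F1 f) = rack_quotient ?A (C1 f)" and B: "tgt (F1 f) = tgt f"
    by (simp_all add: F1_def)
  have "?b \<in> ext_hom (F1 f) g"
    using \<alpha> h unfolding ext_hom_def Q B
    by (auto simp: rack_hom_def quotient_ops[OF R] val arr_F1[OF f] A.tri_closed elim!: quotientE)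
  moreover have "ext_hom_eq f (ext_comp ?b (eta1 f)) \<alpha>"
    by (auto simp: ext_hom_eq_def ext_comp_def eta1_def val)
  moreover have "ext_hom_eq (F1 f) \<beta>' ?b" if "ext_hom_eq f (ext_comp \<beta>' (eta1 f)) \<alpha>" for \<beta>'
    using that unfolding ext_hom_eq_def Q B
    by (auto simp: ext_comp_def eta1_def val elim!: quotientE)
  ultimately show ?thesis by blast
qed

theorem eta1_natural:
  assumes f: "extension \<C> f" and g: "extension \<C> g" and \<alpha>: "\<alpha> \<in> ext_hom f g"
  shows "F1_map g \<alpha> \<in> ext_hom (F1 f) (F1 g)"
    and "ext_hom_eq f (ext_comp (F1_map g \<alpha>) (eta1 f)) (ext_comp (eta1 g) \<alpha>)"
proof -
  let ?A = "src f" and ?B = "src g"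
  let ?\<delta> = "ext_comp (eta1 g) \<alpha>"
  have e: "equiv (carrier ?A) (C1 f)" using C1_props(1)[OF f] by (simp add: rack_congruence_def)
  have eg: "eta1 g \<in> ext_hom g (F1 g)" by (rule eta1_hom[OF g])
  have "rack ?A"  using f rack_of_obj by (auto simp: extension_def)
  then interpret A: rack ?A .
  have "?\<delta> \<in> ext_hom f (F1 g)"
    using \<alpha> eg by (auto simp: ext_hom_def rack_hom_def ext_comp_def Pi_iff extension_def)
  from eta1_universal[OF f covering_F1[OF g] this] obtain \<beta> where
    \<beta>: "\<beta> \<in> ext_hom (F1 f) (F1 g)" "ext_hom_eq f (ext_comp \<beta> (eta1 f)) ?\<delta>" by blast
  have bv: "fst \<beta> (C1 f `` {x}) = C1 g `` {fst \<alpha> x}" if "x \<in> carrier ?A" for x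
    using \<beta>(2) that by (simp add: ext_hom_eq_def ext_comp_def eta1_def)
  have val: "(\<Union>y\<in>C1 f `` {x}. C1 g `` {fst \<alpha> y}) = C1 g `` {fst \<alpha> x}" if x: "x \<in> carrier ?A" for x
  proof -
    have "C1 g `` {fst \<alpha> y} = C1 g `` {fst \<alpha> x}" if y: "(x, y) \<in> C1 f" for y
    proof -
      have "y \<in> carrier ?A" using y e by (auto simp: equiv_def)
      then show ?thesis using bv[of y] bv[OF x] equiv_class_eq[OF e y] by simp
    qed
    moreover have "(x, x) \<in> C1 f" using e x by (auto simp: equiv_def refl_on_def)
    ultimately show ?thesis by blast
  qed
  show "ext_hom_eq f (ext_comp (F1_map g \<alpha>) (eta1 f)) ?\<delta>"
    by (simp add: ext_hom_eq_def ext_comp_def eta1_def F1_map_def val)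
  have Q: "carrier (src (F1 f)) = carrier ?A // C1 f" and B: "tgt (F1 f) = tgt f"
    by (simp_all add: F1_def)
  have t: "fst (F1_map g \<alpha>) X = fst \<beta> X" if "X \<in> carrier (src (F1 f))" for X
    using that unfolding Q by (elim quotientE) (simp add: F1_map_def val bv)
  have s: "snd (F1_map g \<alpha>) x = snd \<beta> x" if "x \<in> carrier (tgt (F1 f))" for x
    using that \<beta>(2) unfolding B by (auto simp: ext_hom_eq_def ext_comp_def eta1_def F1_map_def)
  have "extension \<C> (F1 f)" by (rule covering_extension[OF covering_F1[OF f]])
  then have "rack (src (F1 f))" "rack (tgt (F1 f))"
    "arr (F1 f) \<in> carrier (src (F1 f)) \<rightarrow> carrier (tgt (F1 f))"
    using rack_of_obj by (auto simp: extension_def rack_hom_def)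
  then show "F1_map g \<alpha> \<in> ext_hom (F1 f) (F1 g)"
    using \<beta>(1) by (auto simp: ext_hom_def rack_hom_def t s rack.tri_closed Pi_iff)
qed

end

theory Submission
  imports Defs
begin

text \<open>
  Write \<open>\<alpha> : fA \<rightarrow> fB\<close> with top component \<open>t\<close>. \<open>F1 \<alpha>\<close> inherits the
  conditions of a double extension from \<open>\<alpha>\<close> because the quotient projections are surjective, and
  the units satisfy them because they are moreover identities on the bottom level.
  The content lies in the comparison morphism from \<open>fA\<close> to the pullback. On the top level its surjectivity says
  that \<open>t\<close> lifts the centralizing congruences: whenever
  \<open>(t x, z)\<close> lies in \<open>C1 fB\<close>, there is \<open>x'\<close> with \<open>t x' = z\<close> and \<open>(x, x')\<close> in \<open>C1 fA\<close>
  (lemma \<open>C1_lift\<close>). The remaining comparison condition comes for free, because the bottom component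
  of the target of the comparison morphism is the graph of the bottom component of \<open>\<alpha>\<close>.

  The lifting property has two ingredients. For any surjective morphism \<open>t : A \<rightarrow> B\<close> and any
  congruence on \<open>A\<close>, the pairs of elements of \<open>B\<close> that lift in both directions from every point of
  their fibres form a congruence on \<open>B\<close> (\<open>lifting_congruence\<close>); so it suffices to lift the
  pairs that generate \<open>C1 fB\<close>. Such a pair is determined by \<open>z\<close> and by \<open>a, b\<close> with \<open>fB a = fB b\<close>, and
  \<open>\<alpha>\<close> being a double extension is exactly what allows one to lift \<open>a, b\<close> to elements of \<open>A\<close> with the
  same image under \<open>fA\<close> (\<open>double_extension_lift_kernel_pair\<close>).
\<close>

lemma obj_rack_pullback:
  assumes A: "obj \<C> A" and B: "obj \<C> B" and D: "rack D"
    and h: "h \<in> rack_hom A D" and k: "k \<in> rack_hom B D"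
  shows "obj \<C> (rack_pullback A B h k)"
proof -
  interpret A: rack A using A by (rule rack_of_obj)
  interpret B: rack B using B by (rule rack_of_obj)
  have ht: "h (x \<lhd>\<^bsub>A\<^esub> a) = h x \<lhd>\<^bsub>D\<^esub> h a" if "x \<in> carrier A" "a \<in> carrier A" for x a
    using h that by (auto simp: rack_hom_def)
  have kt: "k (x \<lhd>\<^bsub>B\<^esub> a) = k x \<lhd>\<^bsub>D\<^esub> k a" if "x \<in> carrier B" "a \<in> carrier B" for x a
    using k that by (auto simp: rack_hom_def)
  note hv = hom_trinv[OF A.rack_axioms D h] and kv = hom_trinv[OF B.rack_axioms D k]
  have r: "rack (rack_pullback A B h k)"
  proof (standard, goal_cases)
    case (5 x a b)
    then show ?case
      by (auto simp: rack_pullback_def intro: A.self_distrib B.self_distrib)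
  qed (auto simp: rack_pullback_def A.tri_closed A.trinv_closed B.tri_closed B.trinv_closed
         A.tri_trinv A.trinv_tri B.tri_trinv B.trinv_tri ht kt hv kv)
  show ?thesis
  proof (cases \<C>)
    case Racks
    then show ?thesis using r by simp
  next
    case Quandles
    then have "quandle A" "quandle B" using A B by simp_all
    then have "quandle (rack_pullback A B h k)"
      by (intro quandle.intro r quandle_axioms.intro)
        (auto simp: rack_pullback_def quandle.idem)
    then show ?thesis using Quandles by simp
  qed
qed

section \<open>Lifting congruences along surjective morphisms\<close>

definition lifts :: "'a rack_struct \<Rightarrow> ('a \<times> 'a) set \<Rightarrow> ('a \<Rightarrow> 'b) \<Rightarrow> 'b \<Rightarrow> 'b \<Rightarrow> bool" where
  "lifts A R t z w \<longleftrightarrow> (\<forall>x\<in>carrier A. t x = z \<longrightarrow> (\<exists>y. (x, y) \<in> R \<and> t y = w))"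

text \<open>
  Lifting is compatible with the operations because right translations are invertible: a point over
  \<open>z \<lhd> u\<close> is \<open>x \<lhd> a\<close> for some \<open>a\<close> over \<open>u\<close> and \<open>x\<close> over \<open>z\<close>, so the two factors can be lifted
  separately.
\<close>

lemma lifts_ops:
  assumes A: "rack A" and B: "rack B" and t: "t \<in> rack_hom A B"
    and surj: "t ` carrier A = carrier B" and R: "rack_congruence A R"
    and zw: "z \<in> carrier B" "lifts A R t z w" and uv: "u \<in> carrier B" "lifts A R t u v"
  shows "lifts A R t (z \<lhd>\<^bsub>B\<^esub> u) (w \<lhd>\<^bsub>B\<^esub> v)" and "lifts A R t (z \<rhd>\<^bsub>B\<^esub> u) (w \<rhd>\<^bsub>B\<^esub> v)"
proof -
  interpret A: rack A by (rule A)
  interpret B: rack B by (rule B)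
  have tt: "t (x \<lhd>\<^bsub>A\<^esub> a) = t x \<lhd>\<^bsub>B\<^esub> t a" if "x \<in> carrier A" "a \<in> carrier A" for x a
    using t that by (auto simp: rack_hom_def)
  note tv = hom_trinv[OF A B t]
  have Rc: "x \<in> carrier A" "y \<in> carrier A" if "(x, y) \<in> R" for x y
    using R that by (auto simp: rack_congruence_def equiv_def)
  have Rt: "(x \<lhd>\<^bsub>A\<^esub> a, y \<lhd>\<^bsub>A\<^esub> b) \<in> R" and Rv: "(x \<rhd>\<^bsub>A\<^esub> a, y \<rhd>\<^bsub>A\<^esub> b) \<in> R"
    if "(x, y) \<in> R" "(a, b) \<in> R" for x y a b
    using R that unfolding rack_congruence_def by fast+
  obtain a where a: "a \<in> carrier A" "t a = u" using surj uv(1) by (metis imageE)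
  obtain b where b: "(a, b) \<in> R" "t b = v" using uv(2) a unfolding lifts_def by blast
  show "lifts A R t (z \<lhd>\<^bsub>B\<^esub> u) (w \<lhd>\<^bsub>B\<^esub> v)"
    unfolding lifts_def
  proof (intro ballI impI)
    fix x assume x: "x \<in> carrier A" "t x = z \<lhd>\<^bsub>B\<^esub> u"
    have "t (x \<rhd>\<^bsub>A\<^esub> a) = z" using x a zw(1) uv(1) by (simp add: tv B.tri_trinv)
    then obtain y where y: "(x \<rhd>\<^bsub>A\<^esub> a, y) \<in> R" "t y = w"
      using zw(2) x a A.trinv_closed unfolding lifts_def by blast
    have "(x, y \<lhd>\<^bsub>A\<^esub> b) \<in> R" using Rt[OF y(1) b(1)] x a by (simp add: A.trinv_tri)
    moreover have "t (y \<lhd>\<^bsub>A\<^esub> b) = w \<lhd>\<^bsub>B\<^esub> v" using y b Rc by (simp add: tt)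
    ultimately show "\<exists>y. (x, y) \<in> R \<and> t y = w \<lhd>\<^bsub>B\<^esub> v" by blast
  qed
  show "lifts A R t (z \<rhd>\<^bsub>B\<^esub> u) (w \<rhd>\<^bsub>B\<^esub> v)"
    unfolding lifts_def
  proof (intro ballI impI)
    fix x assume x: "x \<in> carrier A" "t x = z \<rhd>\<^bsub>B\<^esub> u"
    have "t (x \<lhd>\<^bsub>A\<^esub> a) = z" using x a zw(1) uv(1) by (simp add: tt B.trinv_tri)
    then obtain y where y: "(x \<lhd>\<^bsub>A\<^esub> a, y) \<in> R" "t y = w"
      using zw(2) x a A.tri_closed unfolding lifts_def by blast
    have "(x, y \<rhd>\<^bsub>A\<^esub> b) \<in> R" using Rv[OF y(1) b(1)] x a by (simp add: A.tri_trinv)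
    moreover have "t (y \<rhd>\<^bsub>A\<^esub> b) = w \<rhd>\<^bsub>B\<^esub> v" using y b Rc by (simp add: tv)
    ultimately show "\<exists>y. (x, y) \<in> R \<and> t y = w \<rhd>\<^bsub>B\<^esub> v" by blast
  qed
qed

text \<open>Both directions are required for symmetry, as \<open>lifts\<close> alone is only a preorder.\<close>

lemma lifting_congruence:
  assumes A: "rack A" and B: "rack B" and t: "t \<in> rack_hom A B"
    and surj: "t ` carrier A = carrier B" and R: "rack_congruence A R"
  shows "rack_congruence B {(z, w). z \<in> carrier B \<and> w \<in> carrier B \<and>
    lifts A R t z w \<and> lifts A R t w z}" (is "rack_congruence B ?L")
proof -
  interpret B: rack B by (rule B)
  have e: "equiv (carrier A) R" using R by (simp add: rack_congruence_def)
  have refl: "lifts A R t z z" for z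
    using e by (auto simp: lifts_def equiv_def refl_on_def)
  have trans: "lifts A R t z v" if zw: "lifts A R t z w" and wv: "lifts A R t w v" for z w v
    unfolding lifts_def
  proof (intro ballI impI)
    fix x assume "x \<in> carrier A" "t x = z"
    then obtain y where y: "(x, y) \<in> R" "t y = w" using zw unfolding lifts_def by blast
    have "y \<in> carrier A" using y e by (auto simp: equiv_def)
    then obtain y' where "(y, y') \<in> R" "t y' = v" using wv y unfolding lifts_def by blast
    moreover have "trans R" using e by (simp add: equiv_def)
    ultimately show "\<exists>y. (x, y) \<in> R \<and> t y = v" using y(1) by (blast dest: transD)
  qed
  show ?thesis
    unfolding rack_congruence_def
  proof (intro conjI equivI)
    show "?L \<subseteq> carrier B \<times> carrier B" by auto
    show "refl_on (carrier B) ?L" using refl by (auto intro: refl_onI)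
    show "sym ?L" by (auto intro: symI)
    show "trans ?L" by (rule transI) (auto intro: trans)
    show "\<forall>(x, y)\<in>?L. \<forall>(a, b)\<in>?L. (x \<lhd>\<^bsub>B\<^esub> a, y \<lhd>\<^bsub>B\<^esub> b) \<in> ?L \<and> (x \<rhd>\<^bsub>B\<^esub> a, y \<rhd>\<^bsub>B\<^esub> b) \<in> ?L"
      using lifts_ops[OF assms] by (auto simp: B.tri_closed B.trinv_closed)
  qed
qed

section \<open>Lifting along double extensions\<close>

lemma double_extension_lift_kernel_pair:
  assumes d: "double_extension \<C> f g \<alpha>"
    and ab: "a \<in> carrier (src g)" "b \<in> carrier (src g)" "arr g a = arr g b"
  obtains a' b' where "a' \<in> carrier (src f)" "b' \<in> carrier (src f)" "arr f a' = arr f b'"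
    "fst \<alpha> a' = a" "fst \<alpha> b' = b"
proof -
  obtain a' where a': "a' \<in> carrier (src f)" "fst \<alpha> a' = a"
    using d ab(1) unfolding double_extension_def by (metis imageE)
  have "(arr f a', b) \<in> carrier (rack_pullback (tgt f) (src g) (snd \<alpha>) (arr g))"
    using d a' ab
    by (auto simp: rack_pullback_def double_extension_def ext_hom_def extension_def rack_hom_def)
  then have "(arr f a', b) \<in> (\<lambda>x. (arr f x, fst \<alpha> x)) ` carrier (src f)"
    using d by (simp add: double_extension_def)
  then obtain b' where "b' \<in> carrier (src f)" "arr f b' = arr f a'" "fst \<alpha> b' = b" by auto
  then show ?thesis using that a' by metis
qed

text \<open>
  A generating pair \<open>(z \<lhd> a \<rhd> b, z)\<close> lifts from both sides because its inverse, from
  \<open>y = z \<lhd> a \<rhd> b\<close> back to \<open>z = y \<lhd> b \<rhd> a\<close>, is a generating step again.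
\<close>

lemma C1_lift:
  assumes d: "double_extension \<C> f g \<alpha>"
    and x: "x \<in> carrier (src f)" and z: "(fst \<alpha> x, z) \<in> C1 g"
  obtains y where "(x, y) \<in> C1 f" "fst \<alpha> y = z"
proof -
  let ?A = "src f" and ?B = "src g" and ?t = "fst \<alpha>"
  have f: "extension \<C> f" and t: "?t \<in> rack_hom ?A ?B" and surj: "?t ` carrier ?A = carrier ?B"
    using d by (auto simp: double_extension_def ext_hom_def)
  have rA: "rack ?A" and rB: "rack ?B"
    using d rack_of_obj by (auto simp: double_extension_def extension_def)
  interpret A: rack ?A by (rule rA)
  interpret B: rack ?B by (rule rB)
  have R: "rack_congruence ?A (C1 f)" by (rule C1_props(1)[OF f])
  then have sym: "(y, x) \<in> C1 f" if "(x, y) \<in> C1 f" for x y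
    using that by (meson equivE rack_congruence_def symD)
  have tt: "?t (x \<lhd>\<^bsub>?A\<^esub> a) = ?t x \<lhd>\<^bsub>?B\<^esub> ?t a" if "x \<in> carrier ?A" "a \<in> carrier ?A" for x a
    using t that by (auto simp: rack_hom_def)
  note tv = hom_trinv[OF rA rB t]
  have step: "lifts ?A (C1 f) ?t y (y \<lhd>\<^bsub>?B\<^esub> a \<rhd>\<^bsub>?B\<^esub> b)"
    if ab: "a \<in> carrier ?B" "b \<in> carrier ?B" "arr g a = arr g b" for y a b
  proof -
    obtain a' b' where c: "a' \<in> carrier ?A" "b' \<in> carrier ?A" and eq: "arr f a' = arr f b'"
      and im: "?t a' = a" "?t b' = b"
      using double_extension_lift_kernel_pair[OF d ab] by metis
    show ?thesis
      unfolding lifts_def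
    proof (intro ballI impI)
      fix x assume x: "x \<in> carrier ?A" "?t x = y"
      have "(x, x \<lhd>\<^bsub>?A\<^esub> a' \<rhd>\<^bsub>?A\<^esub> b') \<in> C1 f" by (rule sym[OF C1_props(2)[OF f x(1) c eq]])
      moreover have "?t (x \<lhd>\<^bsub>?A\<^esub> a' \<rhd>\<^bsub>?A\<^esub> b') = y \<lhd>\<^bsub>?B\<^esub> a \<rhd>\<^bsub>?B\<^esub> b"
        using x c im by (simp add: tt tv A.tri_closed)
      ultimately show "\<exists>x'. (x, x') \<in> C1 f \<and> ?t x' = y \<lhd>\<^bsub>?B\<^esub> a \<rhd>\<^bsub>?B\<^esub> b" by blast
    qed
  qed
  have "C1 g \<subseteq> {(z, w). z \<in> carrier ?B \<and> w \<in> carrier ?B \<and>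
      lifts ?A (C1 f) ?t z w \<and> lifts ?A (C1 f) ?t w z}"
    unfolding C1_def[of g]
  proof (rule generated_congruence_least[OF lifting_congruence[OF rA rB t surj R]], clarify, intro conjI)
    fix z a b
    assume c: "z \<in> carrier ?B" "a \<in> carrier ?B" "b \<in> carrier ?B" and ab: "arr g a = arr g b"
    let ?y = "z \<lhd>\<^bsub>?B\<^esub> a \<rhd>\<^bsub>?B\<^esub> b"
    show "?y \<in> carrier ?B" using c by (simp add: B.tri_closed B.trinv_closed)
    have "?y \<lhd>\<^bsub>?B\<^esub> b \<rhd>\<^bsub>?B\<^esub> a = z"
      using c by (simp add: B.trinv_tri B.tri_trinv B.tri_closed)
    then show "lifts ?A (C1 f) ?t ?y z"
      using step[OF c(3,2) ab[symmetric], of ?y] by simp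
    show "lifts ?A (C1 f) ?t z ?y" by (rule step[OF c(2,3) ab])
  qed (use B.tri_closed in auto)
  then have "lifts ?A (C1 f) ?t (?t x) z" using z by auto
  then show ?thesis using that x unfolding lifts_def by blast
qed

section \<open>The faces and the comparison morphism of the reflection square\<close>

lemma src_F1: "carrier (src (F1 f)) = (\<lambda>x. C1 f `` {x}) ` carrier (src f)"
  by (auto simp: F1_def quotient_def)

lemma tgt_F1: "tgt (F1 f) = tgt f"
  by (simp add: F1_def)

lemma eta1_apply: "fst (eta1 f) x = C1 f `` {x}" "snd (eta1 f) a = a"
  by (simp_all add: eta1_def)

lemma snd_F1_map: "snd (F1_map g \<alpha>) = snd \<alpha>"
  by (simp add: F1_map_def)

lemma extension_F1: "extension \<C> f \<Longrightarrow> extension \<C> (F1 f)"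
  by (rule covering_extension[OF covering_F1])

lemma F1_map_class:
  assumes "extension \<C> f" "extension \<C> g" "\<alpha> \<in> ext_hom f g" "x \<in> carrier (src f)"
  shows "fst (F1_map g \<alpha>) (C1 f `` {x}) = C1 g `` {fst \<alpha> x}"
  using eta1_natural(2)[OF assms(1-3)] assms(4)
  by (simp add: ext_hom_eq_def ext_comp_def eta1_apply)

lemma double_extension_eta1:
  assumes f: "extension \<C> f"
  shows "double_extension \<C> f (F1 f) (eta1 f)"
proof -
  have "arr f x \<in> carrier (tgt f)" if "x \<in> carrier (src f)" for x
    using f that by (auto simp: extension_def)
  then show ?thesis
    unfolding double_extension_def
    using f extension_F1[OF f] eta1_hom[OF f]
    by (auto simp: eta1_apply src_F1 tgt_F1 rack_pullback_def arr_F1[OF f])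
qed

lemma double_extension_F1_map:
  assumes d: "double_extension \<C> f g \<alpha>"
  shows "double_extension \<C> (F1 f) (F1 g) (F1_map g \<alpha>)"
proof -
  have f: "extension \<C> f" and g: "extension \<C> g" and \<alpha>: "\<alpha> \<in> ext_hom f g"
    and top: "fst \<alpha> ` carrier (src f) = carrier (src g)"
    and bot: "snd \<alpha> ` carrier (tgt f) = carrier (tgt g)"
    and comp: "(\<lambda>x. (arr f x, fst \<alpha> x)) ` carrier (src f) =
       carrier (rack_pullback (tgt f) (src g) (snd \<alpha>) (arr g))"
    using d by (auto simp: double_extension_def)
  note val = F1_map_class[OF f g \<alpha>]
  have "fst (F1_map g \<alpha>) ` carrier (src (F1 f)) = carrier (src (F1 g))"
    using val by (simp add: src_F1 image_image top[symmetric])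
  moreover have "(\<lambda>X. (arr (F1 f) X, fst (F1_map g \<alpha>) X)) ` carrier (src (F1 f)) =
       carrier (rack_pullback (tgt (F1 f)) (src (F1 g)) (snd (F1_map g \<alpha>)) (arr (F1 g)))"
  proof -
    have "(\<lambda>X. (arr (F1 f) X, fst (F1_map g \<alpha>) X)) ` carrier (src (F1 f)) =
      map_prod id (\<lambda>z. C1 g `` {z}) ` (\<lambda>x. (arr f x, fst \<alpha> x)) ` carrier (src f)"
      using val arr_F1[OF f] by (simp add: src_F1 image_image)
    also have "\<dots> = carrier (rack_pullback (tgt (F1 f)) (src (F1 g)) (snd (F1_map g \<alpha>)) (arr (F1 g)))"
      unfolding comp
      by (auto simp: rack_pullback_def src_F1 tgt_F1 snd_F1_map arr_F1[OF g] image_iff) blast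
    finally show ?thesis .
  qed
  ultimately show ?thesis
    unfolding double_extension_def
    using extension_F1[OF f] extension_F1[OF g] eta1_natural(1)[OF f g \<alpha>] bot
    by (simp add: tgt_F1 snd_F1_map)
qed

text \<open>
  A point of the bottom level is \<open>(snd \<alpha> a, a)\<close>; any \<open>x\<close> over \<open>a\<close> gives the preimage
  \<open>(fst \<alpha> x, [x])\<close>, so the pullback of extensions is again surjective.
\<close>

lemma extension_reflection_pullback:
  assumes d: "double_extension \<C> f g \<alpha>"
  shows "extension \<C> (ext_pullback g (F1 f) (eta1 g) (F1_map g \<alpha>))" (is "extension \<C> ?P")
proof -
  have f: "extension \<C> f" and g: "extension \<C> g" and \<alpha>: "\<alpha> \<in> ext_hom f g"
    using d by (auto simp: double_extension_def)
  note val = F1_map_class[OF f g \<alpha>]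
  have P: "src ?P = rack_pullback (src g) (src (F1 f)) (fst (eta1 g)) (fst (F1_map g \<alpha>))"
    "tgt ?P = rack_pullback (tgt g) (tgt (F1 f)) (snd (eta1 g)) (snd (F1_map g \<alpha>))"
    "arr ?P = map_prod (arr g) (arr (F1 f))"
    by (simp_all add: ext_pullback_def)
  have F: "extension \<C> (F1 f)" "extension \<C> (F1 g)" using f g extension_F1 by auto
  note e = eta1_hom[OF g] eta1_natural(1)[OF f g \<alpha>]
  have rk: "rack (src (F1 g))" "rack (tgt (F1 g))"
    using F(2) rack_of_obj by (auto simp: extension_def)
  have o: "obj \<C> (src ?P)" "obj \<C> (tgt ?P)"
    unfolding P using g F(1) e
    by (auto intro!: obj_rack_pullback[OF _ _ rk(1)] obj_rack_pullback[OF _ _ rk(2)]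
        simp: extension_def ext_hom_def)
  have in_tgt: "map_prod (arr g) (arr (F1 f)) p \<in> carrier (tgt ?P)" if "p \<in> carrier (src ?P)" for p
  proof -
    obtain z X where p: "p = (z, X)" by (cases p)
    have c: "z \<in> carrier (src g)" "X \<in> carrier (src (F1 f))"
      "fst (eta1 g) z = fst (F1_map g \<alpha>) X"
      using that by (auto simp: P p rack_pullback_def)
    have "snd (eta1 g) (arr g z) = arr (F1 g) (fst (eta1 g) z)"
      using e(1) c(1) by (simp add: ext_hom_def)
    also have "\<dots> = snd (F1_map g \<alpha>) (arr (F1 f) X)"
      using e(2) c(2) by (simp add: ext_hom_def c(3))
    finally show ?thesis
      using c g F(1) by (auto simp: P p rack_pullback_def extension_def)
  qed
  have hom: "arr ?P \<in> rack_hom (src ?P) (tgt ?P)"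
    using in_tgt g F(1) unfolding P(3)
    by (auto simp: rack_hom_def extension_def P rack_pullback_def)
  have "carrier (tgt ?P) \<subseteq> arr ?P ` carrier (src ?P)"
  proof
    fix p assume "p \<in> carrier (tgt ?P)"
    then obtain a where a: "a \<in> carrier (tgt f)" and p: "p = (snd \<alpha> a, a)"
      by (auto simp: P rack_pullback_def tgt_F1 eta1_apply snd_F1_map)
    obtain x where x: "x \<in> carrier (src f)" "arr f x = a"
      using a f unfolding extension_def by (metis imageE)
    have "(fst \<alpha> x, C1 f `` {x}) \<in> carrier (src ?P)"
      using x \<alpha> by (auto simp: P rack_pullback_def src_F1 eta1_apply val ext_hom_def rack_hom_def)
    moreover have "p = arr ?P (fst \<alpha> x, C1 f `` {x})"
      using x \<alpha> by (simp add: P p arr_F1[OF f] ext_hom_def)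
    ultimately show "p \<in> arr ?P ` carrier (src ?P)" by blast
  qed
  then show ?thesis
    unfolding extension_def using o hom in_tgt by (auto simp: P(3))
qed

lemma double_extension_reflection_comparison:
  assumes d: "double_extension \<C> f g \<alpha>"
  shows "double_extension \<C> f (ext_pullback g (F1 f) (eta1 g) (F1_map g \<alpha>)) (ext_pair \<alpha> (eta1 f))"
    (is "double_extension \<C> f ?P ?\<theta>")
proof -
  have f: "extension \<C> f" and g: "extension \<C> g" and \<alpha>: "\<alpha> \<in> ext_hom f g"
    using d by (auto simp: double_extension_def)
  note val = F1_map_class[OF f g \<alpha>]
  have P: "src ?P = rack_pullback (src g) (src (F1 f)) (fst (eta1 g)) (fst (F1_map g \<alpha>))"
    "tgt ?P = rack_pullback (tgt g) (tgt (F1 f)) (snd (eta1 g)) (snd (F1_map g \<alpha>))"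
    "arr ?P = map_prod (arr g) (arr (F1 f))"
    by (simp_all add: ext_pullback_def)
  have \<theta>: "fst ?\<theta> x = (fst \<alpha> x, C1 f `` {x})" "snd ?\<theta> a = (snd \<alpha> a, a)" for x a
    by (simp_all add: ext_pair_def eta1_apply)
  have ec: "equiv (carrier (src f)) (C1 f)"
    using C1_props(1)[OF f] by (simp add: rack_congruence_def)
  have eg: "equiv (carrier (src g)) (C1 g)"
    using C1_props(1)[OF g] by (simp add: rack_congruence_def)
  have in_src: "fst ?\<theta> x \<in> carrier (src ?P)" if "x \<in> carrier (src f)" for x
    using that \<alpha>
    by (auto simp: \<theta> P rack_pullback_def src_F1 eta1_apply val ext_hom_def rack_hom_def)
  have in_tgt: "snd ?\<theta> a \<in> carrier (tgt ?P)" if "a \<in> carrier (tgt f)" for a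
    using that \<alpha>
    by (auto simp: \<theta> P rack_pullback_def tgt_F1 eta1_apply snd_F1_map ext_hom_def rack_hom_def)
  have hom: "?\<theta> \<in> ext_hom f ?P"
  proof -
    note e = eta1_hom[OF f]
    have "fst ?\<theta> \<in> rack_hom (src f) (src ?P)"
      using in_src \<alpha> e unfolding rack_hom_def
      by (auto simp: ext_hom_def rack_hom_def \<theta> P rack_pullback_def eta1_apply)
    moreover have "snd ?\<theta> \<in> rack_hom (tgt f) (tgt ?P)"
      using in_tgt \<alpha> unfolding rack_hom_def
      by (auto simp: ext_hom_def rack_hom_def \<theta> P rack_pullback_def tgt_F1)
    ultimately show ?thesis
      using \<alpha> by (auto simp: ext_hom_def \<theta> P arr_F1[OF f])
  qed
  have top: "\<exists>x\<in>carrier (src f). fst ?\<theta> x = p" if p: "p \<in> carrier (src ?P)" for p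
  proof -
    obtain z x where x: "x \<in> carrier (src f)" and z: "z \<in> carrier (src g)"
      and p: "p = (z, C1 f `` {x})" and "C1 g `` {z} = C1 g `` {fst \<alpha> x}"
      using p by (auto simp: P rack_pullback_def src_F1 eta1_apply val)
    then have "(fst \<alpha> x, z) \<in> C1 g"
      using eq_equiv_class[OF _ eg z, of "fst \<alpha> x"] by simp
    then obtain y where y: "(x, y) \<in> C1 f" "fst \<alpha> y = z" using C1_lift[OF d x] by metis
    have "y \<in> carrier (src f)" using y ec by (auto simp: equiv_def)
    then show ?thesis using y equiv_class_eq[OF ec y(1)] by (auto simp: \<theta> p)
  qed
  have bot: "carrier (tgt ?P) \<subseteq> snd ?\<theta> ` carrier (tgt f)"
    by (auto simp: \<theta> P rack_pullback_def tgt_F1 eta1_apply snd_F1_map)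
  have "carrier (rack_pullback (tgt f) (src ?P) (snd ?\<theta>) (arr ?P)) \<subseteq>
      (\<lambda>x. (arr f x, fst ?\<theta> x)) ` carrier (src f)"
  proof
    fix q assume "q \<in> carrier (rack_pullback (tgt f) (src ?P) (snd ?\<theta>) (arr ?P))"
    then obtain a p where q: "q = (a, p)" and p: "p \<in> carrier (src ?P)" and eq: "snd ?\<theta> a = arr ?P p"
      by (auto simp: rack_pullback_def)
    obtain x where x: "x \<in> carrier (src f)" "fst ?\<theta> x = p" using top[OF p] by blast
    \<comment> \<open>The second coordinate of \<open>snd ?\<theta> a\<close> is \<open>a\<close> itself, so a preimage of \<open>p\<close> must lie over \<open>a\<close>.\<close>
    have "snd ?\<theta> a = snd ?\<theta> (arr f x)" using eq hom x by (auto simp: ext_hom_def)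
    then have "arr f x = a" by (simp add: \<theta>)
    then show "q \<in> (\<lambda>x. (arr f x, fst ?\<theta> x)) ` carrier (src f)" using x q by blast
  qed
  moreover have "(\<lambda>x. (arr f x, fst ?\<theta> x)) ` carrier (src f) \<subseteq>
      carrier (rack_pullback (tgt f) (src ?P) (snd ?\<theta>) (arr ?P))"
  proof
    fix q assume "q \<in> (\<lambda>x. (arr f x, fst ?\<theta> x)) ` carrier (src f)"
    then obtain x where "x \<in> carrier (src f)" "q = (arr f x, fst ?\<theta> x)" by blast
    moreover have "arr f x \<in> carrier (tgt f)" if "x \<in> carrier (src f)" for x
      using f that by (auto simp: extension_def)
    ultimately show "q \<in> carrier (rack_pullback (tgt f) (src ?P) (snd ?\<theta>) (arr ?P))"
      using hom in_src by (simp add: rack_pullback_def[of "tgt f" "src ?P"] ext_hom_def)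
  qed
  ultimately show ?thesis
    unfolding double_extension_def
    using f extension_reflection_pullback[OF d] hom in_src in_tgt top bot by blast
qed

theorem theorem2p3p2:
  fixes \<C> :: rack_category
    and fA :: "('a1, 'a2) arrow"
    and fB :: "('b1, 'b2) arrow"
    and \<alpha> :: "('a1 \<Rightarrow> 'b1) \<times> ('a2 \<Rightarrow> 'b2)"
  assumes "double_extension \<C> fA fB \<alpha>"
  shows "three_fold_extension \<C> fA fB (F1 fA) (F1 fB) \<alpha> (F1_map fB \<alpha>) (eta1 fA) (eta1 fB)"
proof -
  have f: "extension \<C> fA" and g: "extension \<C> fB" and \<alpha>: "\<alpha> \<in> ext_hom fA fB"
    using assms by (auto simp: double_extension_def)
  show ?thesis
    unfolding three_fold_extension_def
    by (intro conjI assms double_extension_F1_map double_extension_eta1 f g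
        eta1_natural(2)[OF f g \<alpha>] double_extension_reflection_comparison)
qed

end
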